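(* For all barriers $B$, $\mathsf{RRT}^B_2\leq_{\mathrm{sW}}\mathsf{FS}^B$.
   Context: $\mathbb{N}$ is the set of natural numbers (including $0$). Subsets of $\mathbb{N}$ are identified with their strictly increasing enumerations; $s\sqsubset Y$ means that $s$ is a proper initial segment of $Y$ as a sequence; $\subset$ is strict set inclusion. A set $B$ of finite subsets of $\mathbb{N}$ is a barrier on an infinite set $X\subseteq\mathbb{N}$ if: (1) $\bigcup B=X$; (2) for all $s,t\in B$, $s\not\subset t$; (3) for every infinite $Y\subseteq X$ there is $s\in B$ with $s\sqsubset Y$. The set $X=\bigcup B$ is the base of $B$. For infinite $Y\subseteq X$, $B\vert Y=\{s\in B: s\subseteq Y\}$ (this is a barrier on $Y$, and every barrier $B'\subseteq B$ has this form). A function $f:B\to\mathbb{N}$ is $2$-bounded if $|f^{-1}(x)|\le 2$ for every $x\in\mathbb{N}$. $\mathsf{RRT}^B_2$ is the problem whose instances are the $2$-bounded functions $f:B\to\mathbb{N}$, where a solution to $f$ is an infinite $Y$ contained in the base of $B$ such that $f$ is injective on $B\vert Y$. $\mathsf{FS}^B$ is the problem whose instances are the functions $f:B\to\mathbb{N}$, where a solution to $f$ is an infinite $Y$ contained in the base of $B$ such that for all $s\in B\vert Y$, if $f(s)\in Y$ then $f(s)\in s$. Instances and solutions are coded as subsets of $\mathbb{N}$ in a standard way, a coloring being given together with its domain (so that the barrier is uniformly computable from a coloring of it). For such problems $\mathsf{P},\mathsf{Q}$, $\mathsf{Q}\leq_{\mathrm{sW}}\mathsf{P}$ (strong Weihrauch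 reducibility) means: there are Turing functionals $\Phi,\Psi$ such that for every instance $I$ of $\mathsf{Q}$, $\Phi(I)$ is an instance of $\mathsf{P}$, and for every solution $\hat Y$ to $\Phi(I)$, $\Psi(\hat Y)$ is a solution to $I$ for $\mathsf{Q}$. *)

theory Defs
  imports "HOL-Library.Nat_Bijection" "HOL-Library.Infinite_Set"
begin

text \<open>
  Programs for the partial functions on the natural numbers that are recursive relative to a set
  oracle, after Kleene. The relation \<open>oeval A p xs y\<close> says that \<open>p\<close> with oracle \<open>A\<close>
  halts on the arguments \<open>xs\<close> with output \<open>y\<close>. \<open>Succ\<close> and \<open>Oracle\<close>
  are unary and diverge on lists of any other length, \<open>Proj i\<close> diverges on lists of length at
  most \<open>i\<close>, and \<open>Zero\<close> is constant on lists of every length.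
\<close>

datatype oprog =
    Zero
  | Succ
  | Proj nat
  | Oracle
  | Comp oprog "oprog list"
  | PrimRec oprog oprog
  | Mu oprog

inductive oeval :: "nat set \<Rightarrow> oprog \<Rightarrow> nat list \<Rightarrow> nat \<Rightarrow> bool" for A :: "nat set" where
  zero: "oeval A Zero xs 0"
| succ: "oeval A Succ [x] (Suc x)"
| proj: "i < length xs \<Longrightarrow> oeval A (Proj i) xs (xs ! i)"
| query: "oeval A Oracle [x] (of_bool (x \<in> A))"
| comp: "list_all2 (\<lambda>g y. oeval A g xs y) gs ys \<Longrightarrow> oeval A f ys z \<Longrightarrow> oeval A (Comp f gs) xs z"
| prim_zero: "oeval A f xs y \<Longrightarrow> oeval A (PrimRec f g) (0 # xs) y"
| prim_suc: "oeval A (PrimRec f g) (n # xs) r \<Longrightarrow> oeval A g (n # r # xs) y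
    \<Longrightarrow> oeval A (PrimRec f g) (Suc n # xs) y"
| mu: "oeval A f (n # xs) 0 \<Longrightarrow> \<forall>m<n. \<exists>k>0. oeval A f (m # xs) k \<Longrightarrow> oeval A (Mu f) xs n"

inductive_cases oeval_zeroE: "oeval A Zero xs y"
inductive_cases oeval_succE: "oeval A Succ xs y"
inductive_cases oeval_projE: "oeval A (Proj i) xs y"
inductive_cases oeval_OracleE: "oeval A Oracle xs y"
inductive_cases oeval_compE: "oeval A (Comp f gs) xs y"
inductive_cases oeval_prim_zeroE: "oeval A (PrimRec f g) (0 # xs) y"
inductive_cases oeval_prim_sucE: "oeval A (PrimRec f g) (Suc n # xs) y"
inductive_cases oeval_muE: "oeval A (Mu f) xs y"

lemma oeval_deterministic: "oeval A p xs y \<Longrightarrow> oeval A p xs z \<Longrightarrow> y = z"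
proof (induction p xs y arbitrary: z rule: oeval.induct)
  case (comp xs gs ys f z')
  from comp.prems obtain ys' where
    ys': "list_all2 (\<lambda>g y. oeval A g xs y) gs ys'" "oeval A f ys' z"
    by (elim oeval_compE)
  have "ys = ys'"
  proof (rule nth_equalityI)
    show "length ys = length ys'"
      using comp.IH(1) ys'(1) by (simp add: list_all2_conv_all_nth)
    show "ys ! i = ys' ! i" if "i < length ys" for i
      using comp.IH(1) ys'(1) that by (simp add: list_all2_conv_all_nth)
  qed
  then show ?case using comp.IH(2) ys'(2) by blast
next
  case (prim_suc f g n xs r y)
  from prim_suc.prems obtain r' where
    r': "oeval A (PrimRec f g) (n # xs) r'" "oeval A g (n # r' # xs) z"
    by (elim oeval_prim_sucE)
  then show ?case using prim_suc.IH by blast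
next
  case (mu f n xs)
  from mu.prems have z: "oeval A f (z # xs) 0" "\<forall>m<z. \<exists>k>0. oeval A f (m # xs) k"
    by - (erule oeval_muE, assumption)+
  show ?case
  proof (rule linorder_cases[of n z])
    assume "n < z"
    then obtain k where "k > 0" "oeval A f (n # xs) k" using z(2) by blast
    then show ?thesis using mu.IH(1)[of k] by simp
  next
    assume "z < n"
    then obtain k where "k > 0" "\<forall>y. oeval A f (z # xs) y \<longrightarrow> k = y" using mu.IH(2) by blast
    then show ?thesis using z(1) by simp
  qed simp
next
  case (zero xs)
  then show ?case by (elim oeval_zeroE) simp
next
  case (succ x)
  then show ?case by (elim oeval_succE) simp
next
  case (proj i xs)
  from proj.prems show ?case by (elim oeval_projE) simp
next
  case (query x)
  then show ?case by (elim oeval_OracleE) simp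
next
  case (prim_zero f xs y g)
  from prim_zero.prems show ?case by (elim oeval_prim_zeroE) (rule prim_zero.IH)
qed

text \<open>
  The functional of a program sends \<open>A\<close> to the set whose characteristic function the program
  computes from \<open>A\<close>, and is undefined if it computes no characteristic function.
\<close>

definition functional :: "oprog \<Rightarrow> nat set \<rightharpoonup> nat set" where
  "functional p A =
    (if \<forall>n. oeval A p [n] 0 \<or> oeval A p [n] 1 then Some {n. oeval A p [n] 1} else None)"

definition turing_functional :: "(nat set \<rightharpoonup> nat set) \<Rightarrow> bool" where
  "turing_functional \<Phi> \<longleftrightarrow> (\<exists>p. \<Phi> = functional p)"

lemma functional_eq_Some_iff:
  "functional p A = Some C \<longleftrightarrow> (\<forall>n. oeval A p [n] (of_bool (n \<in> C)))"
proof
  assume "functional p A = Some C"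
  then show "\<forall>n. oeval A p [n] (of_bool (n \<in> C))"
    by (auto simp: functional_def of_bool_def split: if_splits)
next
  assume *: "\<forall>n. oeval A p [n] (of_bool (n \<in> C))"
  have "oeval A p [n] 1 \<longleftrightarrow> n \<in> C" for n
  proof
    assume "oeval A p [n] 1"
    from oeval_deterministic[OF this spec[OF *, of n]] show "n \<in> C"
      by (cases "n \<in> C") auto
  next
    assume "n \<in> C"
    then show "oeval A p [n] 1" using spec[OF *, of n] by simp
  qed
  moreover have "oeval A p [n] 0 \<or> oeval A p [n] 1" for n
    using spec[OF *, of n] by (cases "n \<in> C") auto
  ultimately show "functional p A = Some C" by (simp add: functional_def)
qed

record problem =
  instances :: "nat set set"
  solutions :: "nat set \<Rightarrow> nat set set"

definition sW_reducible :: "problem \<Rightarrow> problem \<Rightarrow> bool"  (infix \<open>\<le>\<^sub>s\<^sub>W\<close> 50) where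
  "Q \<le>\<^sub>s\<^sub>W P \<longleftrightarrow>
    (\<exists>\<Phi> \<Psi>. turing_functional \<Phi> \<and> turing_functional \<Psi> \<and>
      (\<forall>I \<in> instances Q. \<exists>J \<in> instances P. \<Phi> I = Some J \<and>
        (\<forall>Y \<in> solutions P J. \<exists>Z \<in> solutions Q I. \<Psi> Y = Some Z)))"

text \<open>
  Meant for infinite \<open>Y\<close> only, where the proper initial segments are the finite ones;
  \<open>enumerate Y\<close> is not the enumeration of \<open>Y\<close> when \<open>Y\<close> is finite.
\<close>

definition init_seg :: "nat set \<Rightarrow> nat set \<Rightarrow> bool"  (infix \<open>\<sqsubset>\<close> 50) where
  "s \<sqsubset> Y \<longleftrightarrow> finite s \<and> sorted_list_of_set s = map (enumerate Y) [0..<card s]"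

definition barrier_on :: "nat set set \<Rightarrow> nat set \<Rightarrow> bool" where
  "barrier_on B X \<longleftrightarrow>
    infinite X \<and> (\<forall>s\<in>B. finite s) \<and>
    \<Union>B = X \<and>
    (\<forall>s\<in>B. \<forall>t\<in>B. \<not> s \<subset> t) \<and>
    (\<forall>Y. infinite Y \<and> Y \<subseteq> X \<longrightarrow> (\<exists>s\<in>B. s \<sqsubset> Y))"

definition barrier :: "nat set set \<Rightarrow> bool" where
  "barrier B \<longleftrightarrow> (\<exists>X. barrier_on B X)"

definition base :: "nat set set \<Rightarrow> nat set" where
  "base B = \<Union>B"

definition restr :: "nat set set \<Rightarrow> nat set \<Rightarrow> nat set set"  (infixl \<open>\<restriction>\<close> 70) where
  "B \<restriction> Y = {s \<in> B. s \<subseteq> Y}"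

text \<open>
  A coloring \<open>f : B \<rightarrow> \<nat>\<close> is coded by the join of (the codes of) its domain and its graph. The graph
  alone would make the domain only enumerable, not computable, from the code.
  Colorings are represented by total functions, whose values outside \<open>B\<close> do not matter.
\<close>

definition coloring_code :: "nat set set \<Rightarrow> (nat set \<Rightarrow> nat) \<Rightarrow> nat set" where
  "coloring_code B f =
    {2 * set_encode s |s. s \<in> B} \<union> {2 * prod_encode (set_encode s, f s) + 1 |s. s \<in> B}"

lemma coloring_code_eq_iff:
  assumes "\<forall>s\<in>B. finite s" "\<forall>s\<in>C. finite s"
  shows "coloring_code B f = coloring_code C g \<longleftrightarrow> B = C \<and> (\<forall>s\<in>B. f s = g s)"
proof
  assume eq: "coloring_code B f = coloring_code C g"
  have inj: "set_encode s = set_encode t \<longleftrightarrow> s = t" if "finite s" "finite t" for s t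
    using inj_on_eq_iff[OF inj_on_set_encode, of s t] that by simp
  have parity: "2 * m \<noteq> Suc (2 * n)" "Suc (2 * n) \<noteq> 2 * m" for m n :: nat
    by presburger+
  have even: "2 * set_encode s \<in> coloring_code D h \<longleftrightarrow> s \<in> D"
    if "finite s" "\<forall>s\<in>D. finite s" for s D h
    using that by (auto simp: coloring_code_def inj parity)
  have odd: "2 * prod_encode (set_encode s, n) + 1 \<in> coloring_code D h \<longleftrightarrow> s \<in> D \<and> n = h s"
    if "finite s" "\<forall>s\<in>D. finite s" for s n D h
    using that by (auto simp: coloring_code_def inj parity)
  have "s \<in> B \<longleftrightarrow> s \<in> C" if "finite s" for s
    using even[OF that assms(1), of f] even[OF that assms(2), of g] unfolding eq by simp
  then have "B = C" using assms by blast
  moreover have "f s = g s" if "s \<in> B" for s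
  proof -
    have "finite s" using assms(1) that by simp
    then show ?thesis
      using odd[of s B "f s" f] odd[of s C "f s" g] assms that unfolding eq by simp
  qed
  ultimately show "B = C \<and> (\<forall>s\<in>B. f s = g s)" by simp
next
  assume *: "B = C \<and> (\<forall>s\<in>B. f s = g s)"
  then have "{2 * prod_encode (set_encode s, f s) + 1 |s. s \<in> B} =
      {2 * prod_encode (set_encode s, g s) + 1 |s. s \<in> B}"
    by (intro Collect_cong) metis
  then show "coloring_code B f = coloring_code C g" using * by (simp add: coloring_code_def)
qed

definition two_bounded :: "nat set set \<Rightarrow> (nat set \<Rightarrow> nat) \<Rightarrow> bool" where
  "two_bounded B f \<longleftrightarrow> (\<forall>x. finite {s \<in> B. f s = x} \<and> card {s \<in> B. f s = x} \<le> 2)"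

definition RRT2 :: "nat set set \<Rightarrow> problem" where
  "RRT2 B = \<lparr>
    instances = {coloring_code B f |f. two_bounded B f},
    solutions = (\<lambda>I. {Y. \<exists>f. I = coloring_code B f \<and> two_bounded B f \<and>
      infinite Y \<and> Y \<subseteq> base B \<and> inj_on f (B \<restriction> Y)})\<rparr>"

definition FS :: "nat set set \<Rightarrow> problem" where
  "FS B = \<lparr>
    instances = {coloring_code B f |f. True},
    solutions = (\<lambda>I. {Y. \<exists>f. I = coloring_code B f \<and>
      infinite Y \<and> Y \<subseteq> base B \<and> (\<forall>s \<in> B \<restriction> Y. f s \<in> Y \<longrightarrow> f s \<in> s)})\<rparr>"

end

(*
  Given a 2-bounded coloring f of B, let g s be the least element of t - s, where t is the other
  element of B with the same color as s, provided that t has the smaller code. Such an element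
  exists because B is an antichain. If Y is a solution to g and s, t in B|Y had the same color, then
  g s would be an element of Y outside s, a contradiction. Hence Y itself is a solution to f. The
  code of g is computed from the code of f by bounded searches and a search for the value f s.
*)
theory Submission
  imports Defs
begin

section \<open>Uniformly computable functions\<close>

text \<open>One program must serve every oracle in \<open>\<A>\<close>, as a Turing functional does.
  Restricting the oracles permits unbounded searches that are known to halt only on codes of
  colorings.\<close>

definition computable_on ::
    "nat set set \<Rightarrow> nat \<Rightarrow> (nat set \<Rightarrow> nat list \<Rightarrow> nat) \<Rightarrow> bool" where
  "computable_on \<A> k F \<longleftrightarrow> (\<exists>p. \<forall>A\<in>\<A>. \<forall>xs. length xs = k \<longrightarrow> oeval A p xs (F A xs))"

abbreviation decidable_on ::
    "nat set set \<Rightarrow> nat \<Rightarrow> (nat set \<Rightarrow> nat list \<Rightarrow> bool) \<Rightarrow> bool" where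
  "decidable_on \<A> k P \<equiv> computable_on \<A> k (\<lambda>A xs. of_bool (P A xs))"

lemma computable_onE:
  assumes "computable_on \<A> k F"
  obtains p where "\<And>A xs. A \<in> \<A> \<Longrightarrow> length xs = k \<Longrightarrow> oeval A p xs (F A xs)"
  using assms unfolding computable_on_def by blast

lemma computable_onI:
  assumes "\<And>A xs. A \<in> \<A> \<Longrightarrow> length xs = k \<Longrightarrow> oeval A p xs (F A xs)"
  shows "computable_on \<A> k F"
  using assms unfolding computable_on_def by blast

section \<open>Projection, composition and primitive recursion\<close>

lemma list_all2_Proj: "list_all2 (\<lambda>g y. oeval A g xs y) (map Proj [0..<length xs]) xs"
  by (auto simp: list_all2_conv_all_nth intro: oeval.proj)

lemma computable_on_hd:
  assumes "0 < k"
  shows "computable_on \<A> k (\<lambda>A xs. hd xs)"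
proof (rule computable_onI[where p = "Proj 0"])
  fix A :: "nat set" and xs :: "nat list"
  assume "length xs = k"
  then show "oeval A (Proj 0) xs (hd xs)"
    using oeval.proj[of 0 xs A] assms by (cases xs) auto
qed

text \<open>Weakening: each recursion, search or quantifier puts its variable in front of the
  argument list, and \<open>tl\<close> carries a function of the outer variables under it. The
  program composes with all projections except the first.\<close>

lemma computable_on_tl:
  assumes "computable_on \<A> k F"
  shows "computable_on \<A> (Suc k) (\<lambda>A xs. F A (tl xs))"
proof -
  obtain p where p: "\<And>A xs. A \<in> \<A> \<Longrightarrow> length xs = k \<Longrightarrow> oeval A p xs (F A xs)"
    using assms by (rule computable_onE) blast
  show ?thesis
  proof (rule computable_onI[where p = "Comp p (map Proj [1..<Suc k])"])
    fix A and xs :: "nat list" assume A: "A \<in> \<A>" and xs: "length xs = Suc k"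
    have "list_all2 (\<lambda>g y. oeval A g xs y) (map Proj [1..<Suc k]) (tl xs)"
      using xs oeval.proj[of _ xs A]
      by (auto simp: list_all2_conv_all_nth nth_tl simp del: upt_Suc)
    moreover have "oeval A p (tl xs) (F A (tl xs))"
      using p A xs by simp
    ultimately show "oeval A (Comp p (map Proj [1..<Suc k])) xs (F A (tl xs))"
      by (rule oeval.comp)
  qed
qed

text \<open>Meant for \<open>Succ\<close> and \<open>Oracle\<close>, which run only on lists of
  length one. The function \<open>h\<close> takes the oracle as an argument because the answer to a
  query depends on it.\<close>

lemma computable_on_comp1:
  assumes "computable_on \<A> 1 (\<lambda>A xs. h A (hd xs))" "computable_on \<A> k F"
  shows "computable_on \<A> k (\<lambda>A xs. h A (F A xs))"
proof -
  obtain q where q: "\<And>A xs. A \<in> \<A> \<Longrightarrow> length xs = 1 \<Longrightarrow> oeval A q xs (h A (hd xs))"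
    using assms(1) by (rule computable_onE) blast
  obtain p where p: "\<And>A xs. A \<in> \<A> \<Longrightarrow> length xs = k \<Longrightarrow> oeval A p xs (F A xs)"
    using assms(2) by (rule computable_onE) blast
  show ?thesis
  proof (rule computable_onI[where p = "Comp q [p]"])
    fix A and xs :: "nat list" assume A: "A \<in> \<A>" and xs: "length xs = k"
    show "oeval A (Comp q [p]) xs (h A (F A xs))"
      by (rule oeval.comp[where ys = "[F A xs]"]) (use p[OF A xs] q[OF A, of "[F A xs]"] in auto)
  qed
qed

lemma computable_on_Suc:
  assumes "computable_on \<A> k F"
  shows "computable_on \<A> k (\<lambda>A xs. Suc (F A xs))"
proof (rule computable_on_comp1[OF computable_onI assms])
  fix A :: "nat set" and xs :: "nat list"
  assume "length xs = 1"
  then show "oeval A Succ xs (Suc (hd xs))"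
    by (cases xs) (auto intro: oeval.succ)
qed

lemma decidable_on_oracle:
  assumes "computable_on \<A> k F"
  shows "decidable_on \<A> k (\<lambda>A xs. F A xs \<in> A)"
proof (rule computable_on_comp1[OF computable_onI assms])
  fix A :: "nat set" and xs :: "nat list"
  assume "length xs = 1"
  then show "oeval A Oracle xs (of_bool (hd xs \<in> A))"
    using oeval.query[of A "hd xs"] by (cases xs) simp_all
qed

lemma computable_on_0: "computable_on \<A> k (\<lambda>A xs. 0)"
  by (rule computable_onI, rule oeval.zero)

lemma computable_on_const: "computable_on \<A> k (\<lambda>A xs. c)"
  by (induction c) (auto intro: computable_on_0 computable_on_Suc)

text \<open>\<open>G\<close> takes the counter, the previous value and the parameters in the order
  in which \<open>PrimRec\<close> passes them to its step program. The arithmetic operations below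
  are obtained by writing them with \<open>rec_nat\<close>.\<close>

lemma computable_on_rec_nat:
  assumes "computable_on \<A> k F" "computable_on \<A> k Z"
    and "computable_on \<A> (Suc (Suc k)) (\<lambda>A xs. G A (hd xs) (hd (tl xs)) (tl (tl xs)))"
  shows "computable_on \<A> k (\<lambda>A xs. rec_nat (Z A xs) (\<lambda>n r. G A n r xs) (F A xs))"
proof -
  obtain p where p: "\<And>A xs. A \<in> \<A> \<Longrightarrow> length xs = k \<Longrightarrow> oeval A p xs (F A xs)"
    using assms(1) by (rule computable_onE) blast
  obtain z where z: "\<And>A xs. A \<in> \<A> \<Longrightarrow> length xs = k \<Longrightarrow> oeval A z xs (Z A xs)"
    using assms(2) by (rule computable_onE) blast
  obtain g where g: "\<And>A xs. A \<in> \<A> \<Longrightarrow> length xs = Suc (Suc k) \<Longrightarrow>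
      oeval A g xs (G A (hd xs) (hd (tl xs)) (tl (tl xs)))"
    using assms(3) by (rule computable_onE) blast
  show ?thesis
  \<comment> \<open>\<open>PrimRec\<close> recurses on the head of its list, so the value of
    \<open>F\<close> is put in front of the unchanged parameters.\<close>
  proof (rule computable_onI[where p = "Comp (PrimRec z g) (p # map Proj [0..<k])"])
    fix A and xs :: "nat list" assume A: "A \<in> \<A>" and xs: "length xs = k"
    have "oeval A (PrimRec z g) (n # xs) (rec_nat (Z A xs) (\<lambda>n r. G A n r xs) n)" for n
    proof (induction n)
      case 0
      then show ?case using z[OF A xs] by (auto intro: oeval.prim_zero)
    next
      case (Suc n)
      then show ?case
        using g[OF A, of "n # rec_nat (Z A xs) (\<lambda>n r. G A n r xs) n # xs"] xs
        by (auto intro: oeval.prim_suc)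
    qed
    moreover have "list_all2 (\<lambda>g y. oeval A g xs y) (p # map Proj [0..<k]) (F A xs # xs)"
      using p[OF A xs] list_all2_Proj[of A xs] xs by simp
    ultimately show "oeval A (Comp (PrimRec z g) (p # map Proj [0..<k])) xs
        (rec_nat (Z A xs) (\<lambda>n r. G A n r xs) (F A xs))"
      by (blast intro: oeval.comp)
  qed
qed

section \<open>Arithmetic\<close>

lemma computable_on_pred:
  assumes "computable_on \<A> k F"
  shows "computable_on \<A> k (\<lambda>A xs. F A xs - 1)"
proof -
  have "computable_on \<A> k (\<lambda>A xs. rec_nat 0 (\<lambda>n r. n) (F A xs))"
    by (intro computable_on_rec_nat assms computable_on_0 computable_on_hd) simp
  moreover have "rec_nat 0 (\<lambda>n r. n) m = m - 1" for m :: nat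
    by (cases m) auto
  ultimately show ?thesis by simp
qed

lemma computable_on_add:
  assumes F: "computable_on \<A> k F" and G: "computable_on \<A> k G"
  shows "computable_on \<A> k (\<lambda>A xs. F A xs + G A xs)"
proof -
  have "computable_on \<A> k (\<lambda>A xs. rec_nat (F A xs) (\<lambda>n r. Suc r) (G A xs))"
    by (intro computable_on_rec_nat assms computable_on_Suc computable_on_tl computable_on_hd) simp
  moreover have "rec_nat a (\<lambda>n r. Suc r) b = a + b" for a b
    by (induction b) auto
  ultimately show ?thesis by simp
qed

lemma computable_on_diff:
  assumes F: "computable_on \<A> k F" and G: "computable_on \<A> k G"
  shows "computable_on \<A> k (\<lambda>A xs. F A xs - G A xs)"
proof -
  have "computable_on \<A> k (\<lambda>A xs. rec_nat (F A xs) (\<lambda>n r. r - 1) (G A xs))"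
    by (intro computable_on_rec_nat assms computable_on_pred computable_on_tl computable_on_hd) simp
  moreover have "rec_nat a (\<lambda>n r. r - 1) b = a - b" for a b :: nat
    by (induction b) auto
  ultimately show ?thesis by simp
qed

lemma computable_on_mult:
  assumes F: "computable_on \<A> k F" and G: "computable_on \<A> k G"
  shows "computable_on \<A> k (\<lambda>A xs. F A xs * G A xs)"
proof -
  have "computable_on \<A> (Suc (Suc k)) (\<lambda>A xs. hd (tl xs) + F A (tl (tl xs)))"
    by (intro computable_on_add computable_on_tl[OF computable_on_tl[OF F]]
        computable_on_tl[OF computable_on_hd]) simp
  then have "computable_on \<A> k (\<lambda>A xs. rec_nat 0 (\<lambda>n r. r + F A xs) (G A xs))"
    by (rule computable_on_rec_nat[OF G computable_on_0])
  moreover have "rec_nat 0 (\<lambda>n r. r + a) b = a * b" for a b :: nat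
    by (induction b) auto
  ultimately show ?thesis by simp
qed

lemma computable_on_power2:
  assumes "computable_on \<A> k F"
  shows "computable_on \<A> k (\<lambda>A xs. 2 ^ F A xs)"
proof -
  have "computable_on \<A> k (\<lambda>A xs. rec_nat 1 (\<lambda>n r. r + r) (F A xs))"
    by (intro computable_on_rec_nat assms computable_on_add computable_on_const
        computable_on_tl computable_on_hd) simp_all
  moreover have "rec_nat 1 (\<lambda>n r. r + r) b = (2 :: nat) ^ b" for b
    by (induction b) auto
  ultimately show ?thesis by simp
qed

section \<open>Boolean operations and comparisons\<close>

lemma decidable_on_not:
  assumes "decidable_on \<A> k P"
  shows "decidable_on \<A> k (\<lambda>A xs. \<not> P A xs)"
proof -
  have "computable_on \<A> k (\<lambda>A xs. 1 - of_bool (P A xs))"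
    by (intro computable_on_diff computable_on_const assms)
  moreover have "1 - of_bool Q = (of_bool (\<not> Q) :: nat)" for Q
    by simp
  ultimately show ?thesis by simp
qed

lemma decidable_on_conj:
  assumes "decidable_on \<A> k P" "decidable_on \<A> k Q"
  shows "decidable_on \<A> k (\<lambda>A xs. P A xs \<and> Q A xs)"
  using computable_on_mult[OF assms] by (simp add: of_bool_conj)

lemma decidable_on_disj:
  assumes "decidable_on \<A> k P" "decidable_on \<A> k Q"
  shows "decidable_on \<A> k (\<lambda>A xs. P A xs \<or> Q A xs)"
  using decidable_on_not[OF decidable_on_conj[OF assms[THEN decidable_on_not]]] by simp

lemma decidable_on_less:
  assumes "computable_on \<A> k F" "computable_on \<A> k G"
  shows "decidable_on \<A> k (\<lambda>A xs. F A xs < G A xs)"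
proof -
  have "computable_on \<A> k (\<lambda>A xs. 1 - (1 - (G A xs - F A xs)))"
    by (intro computable_on_diff computable_on_const assms)
  \<comment> \<open>Subtracting from 1 twice with truncation sends 0 to 0 and every positive number
    to 1.\<close>
  moreover have "1 - (1 - (b - a)) = of_bool (a < b)" for a b :: nat
    by auto
  ultimately show ?thesis by simp
qed

lemma decidable_on_le:
  assumes "computable_on \<A> k F" "computable_on \<A> k G"
  shows "decidable_on \<A> k (\<lambda>A xs. F A xs \<le> G A xs)"
  using decidable_on_not[OF decidable_on_less[OF assms(2,1)]] by (simp add: not_less)

lemma decidable_on_eq:
  assumes "computable_on \<A> k F" "computable_on \<A> k G"
  shows "decidable_on \<A> k (\<lambda>A xs. F A xs = G A xs)"
  using decidable_on_conj[OF decidable_on_le[OF assms] decidable_on_le[OF assms(2,1)]]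
  by (simp add: eq_iff)

section \<open>Minimization and bounded quantifiers\<close>

lemma computable_on_Least:
  assumes P: "decidable_on \<A> (Suc k) (\<lambda>A xs. P A (hd xs) (tl xs))"
    and ex: "\<And>A xs. A \<in> \<A> \<Longrightarrow> length xs = k \<Longrightarrow> \<exists>n. P A n xs"
  shows "computable_on \<A> k (\<lambda>A xs. LEAST n. P A n xs)"
proof -
  \<comment> \<open>\<open>Mu\<close> looks for the value 0, so the program it runs must decide the
    negation of \<open>P\<close>.\<close>
  obtain p where p: "\<And>A xs. A \<in> \<A> \<Longrightarrow> length xs = Suc k \<Longrightarrow>
      oeval A p xs (of_bool (\<not> P A (hd xs) (tl xs)))"
    using decidable_on_not[OF P] by (rule computable_onE) blast
  show ?thesis
  proof (rule computable_onI[where p = "Mu p"])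
    fix A and xs :: "nat list" assume A: "A \<in> \<A>" and xs: "length xs = k"
    have p': "oeval A p (n # xs) (of_bool (\<not> P A n xs))" for n
      using p[OF A, of "n # xs"] xs by simp
    show "oeval A (Mu p) xs (LEAST n. P A n xs)"
    proof (rule oeval.mu)
      have "P A (LEAST n. P A n xs) xs"
        using ex[OF A xs] by (rule LeastI_ex)
      then show "oeval A p ((LEAST n. P A n xs) # xs) 0"
        using p'[of "LEAST n. P A n xs"] by simp
      show "\<forall>m<LEAST n. P A n xs. \<exists>k>0. oeval A p (m # xs) k"
      proof (intro allI impI)
        fix m assume "m < (LEAST n. P A n xs)"
        then have "\<not> P A m xs" by (rule not_less_Least)
        then show "\<exists>k>0. oeval A p (m # xs) k" using p'[of m] by (intro exI[of _ 1]) simp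
      qed
    qed
  qed
qed

text \<open>The search for an \<open>i\<close> that satisfies \<open>P\<close> or has reached the
  bound always halts, and it halts below the bound exactly if a witness exists.\<close>

lemma decidable_on_bex:
  assumes F: "computable_on \<A> k F"
    and P: "decidable_on \<A> (Suc k) (\<lambda>A xs. P A (hd xs) (tl xs))"
  shows "decidable_on \<A> k (\<lambda>A xs. \<exists>i<F A xs. P A i xs)"
proof -
  have "decidable_on \<A> (Suc k) (\<lambda>A xs. F A (tl xs) \<le> hd xs \<or> P A (hd xs) (tl xs))"
    by (intro decidable_on_disj decidable_on_le P computable_on_tl[OF F] computable_on_hd) simp
  then have "computable_on \<A> k (\<lambda>A xs. LEAST i. F A xs \<le> i \<or> P A i xs)"
    by (rule computable_on_Least) blast
  then have "decidable_on \<A> k (\<lambda>A xs. (LEAST i. F A xs \<le> i \<or> P A i xs) < F A xs)"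
    by (rule decidable_on_less[OF _ F])
  moreover have "(LEAST i. m \<le> i \<or> Q i) < m \<longleftrightarrow> (\<exists>i<m. Q i)" for m :: nat and Q
  proof
    assume "(LEAST i. m \<le> i \<or> Q i) < m"
    moreover have "m \<le> (LEAST i. m \<le> i \<or> Q i) \<or> Q (LEAST i. m \<le> i \<or> Q i)"
      by (rule LeastI[of _ m]) simp
    ultimately show "\<exists>i<m. Q i" by auto
  next
    assume "\<exists>i<m. Q i"
    then obtain i where "i < m" "Q i" by blast
    then show "(LEAST i. m \<le> i \<or> Q i) < m"
      using Least_le[of "\<lambda>i. m \<le> i \<or> Q i" i] by simp
  qed
  ultimately show ?thesis by simp
qed

section \<open>Binary codes of finite sets and codes of pairs\<close>

text \<open>Bit \<open>i\<close> of \<open>c\<close> is 1 iff the quotient of \<open>c\<close> by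
  \<open>2 ^ i\<close> is odd. Writing out quotient \<open>Suc (q + q)\<close> and remainder
  \<open>r\<close> replaces the division by bounded quantifiers.\<close>

lemma mem_set_decode_iff:
  "i \<in> set_decode c \<longleftrightarrow> (\<exists>q<Suc c. \<exists>r<2 ^ i. c = Suc (q + q) * 2 ^ i + r)"
proof
  assume "i \<in> set_decode c"
  then have "odd (c div 2 ^ i)" by (simp add: set_decode_def)
  then obtain q where q: "c div 2 ^ i = Suc (q + q)" by (auto elim: oddE simp: mult_2)
  have "c = Suc (q + q) * 2 ^ i + c mod 2 ^ i"
    using div_mult_mod_eq[of c "2 ^ i"] unfolding q by simp
  moreover have "q < Suc c" using q div_le_dividend[of c "2 ^ i"] by linarith
  ultimately show "\<exists>q<Suc c. \<exists>r<2 ^ i. c = Suc (q + q) * 2 ^ i + r"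
    by (metis mod_less_divisor zero_less_numeral zero_less_power)
next
  assume "\<exists>q<Suc c. \<exists>r<2 ^ i. c = Suc (q + q) * 2 ^ i + r"
  then obtain q r where "r < 2 ^ i" "c = Suc (q + q) * 2 ^ i + r" by blast
  then have "c div 2 ^ i = Suc (q + q)"
    by (intro div_nat_eqI) (auto simp: algebra_simps)
  then show "i \<in> set_decode c" by (simp add: set_decode_def)
qed

lemma decidable_on_mem_set_decode:
  assumes F: "computable_on \<A> k F" and G: "computable_on \<A> k G"
  shows "decidable_on \<A> k (\<lambda>A xs. F A xs \<in> set_decode (G A xs))"
  unfolding mem_set_decode_iff
  by (intro decidable_on_bex decidable_on_eq computable_on_add computable_on_mult
      computable_on_power2 computable_on_Suc F G computable_on_tl[OF F]
      computable_on_tl[OF computable_on_tl[OF F]] computable_on_tl[OF computable_on_tl[OF G]]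
      computable_on_tl[OF computable_on_hd] computable_on_hd) simp_all

text \<open>The code of a pair is a triangular number plus \<open>a\<close>. Doubling cancels the
  halving in the triangular number, so the odd elements of a coloring code can be computed without
  division.\<close>

lemma two_prod_encode: "2 * prod_encode (a, b) + 1 = Suc ((a + b) * Suc (a + b) + (a + a))"
  by (simp add: prod_encode_def triangle_def)

lemma computable_on_two_prod_encode:
  assumes "computable_on \<A> k F" "computable_on \<A> k G"
  shows "computable_on \<A> k (\<lambda>A xs. 2 * prod_encode (F A xs, G A xs) + 1)"
  unfolding two_prod_encode
  by (intro computable_on_Suc computable_on_add computable_on_mult assms)

section \<open>Codes of colorings\<close>

lemma set_encode_eq_iff: "finite s \<Longrightarrow> finite t \<Longrightarrow> set_encode s = set_encode t \<longleftrightarrow> s = t"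
  using inj_on_eq_iff[OF inj_on_set_encode, of s t] by simp

text \<open>The summand \<open>2 ^ i\<close> of the code already exceeds \<open>i\<close>.\<close>

lemma less_set_encode:
  assumes "finite s" "i \<in> s"
  shows "i < set_encode s"
proof -
  have "i < 2 ^ i" by simp
  also have "\<dots> \<le> set_encode s"
    unfolding set_encode_def using assms by (intro member_le_sum) auto
  finally show ?thesis .
qed

text \<open>Parity separates the two halves of the join: even elements describe the domain, odd ones
  the graph.\<close>

lemma even_mem_coloring_code:
  "2 * m \<in> coloring_code B f \<longleftrightarrow> (\<exists>s\<in>B. m = set_encode s)"
proof -
  have "2 * m \<noteq> Suc (2 * n)" for n by presburger
  then show ?thesis by (auto simp: coloring_code_def)
qed

lemma odd_mem_coloring_code:
  "2 * m + 1 \<in> coloring_code B f \<longleftrightarrow> (\<exists>s\<in>B. m = prod_encode (set_encode s, f s))"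
proof -
  have "Suc (2 * m) \<noteq> 2 * n" for n by presburger
  then show ?thesis by (auto simp: coloring_code_def)
qed

section \<open>The two searches and their computability\<close>

text \<open>The color of the set with code \<open>a\<close>, read off the graph. If \<open>a\<close>
  codes no element of the domain, the first alternative stops the search at the default value
  0.\<close>

definition color_search :: "nat set \<Rightarrow> nat \<Rightarrow> nat" where
  "color_search A a = (LEAST v. 2 * a \<notin> A \<or> 2 * prod_encode (a, v) + 1 \<in> A)"

text \<open>
  The alternative \<open>a \<le> b\<close> makes the search total without cutting off a witness, since the elements of
  a finite set are smaller than its code.
\<close>

definition twin_search :: "nat set \<Rightarrow> nat \<Rightarrow> nat" where
  "twin_search A a = (LEAST b. a \<le> b \<or>
    (\<exists>c<a. 2 * prod_encode (c, color_search A a) + 1 \<in> A \<and> b \<in> set_decode c \<and> b \<notin> set_decode a))"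

text \<open>For a barrier \<open>B\<close> and \<open>s\<close> in \<open>B\<close>, the value
  defaults to the cutoff \<open>set_encode s\<close> if no set of smaller code in \<open>B\<close>
  has the color of \<open>s\<close>.\<close>

definition twin_coloring :: "nat set set \<Rightarrow> (nat set \<Rightarrow> nat) \<Rightarrow> nat set \<Rightarrow> nat" where
  "twin_coloring B f s = twin_search (coloring_code B f) (set_encode s)"

lemma computable_on_color_search:
  assumes F: "computable_on {coloring_code B f |f. Q f} k F"
  shows "computable_on {coloring_code B f |f. Q f} k (\<lambda>A xs. color_search A (F A xs))"
  \<comment> \<open>Only the doubling in the domain query becomes a sum; the doubled pair code keeps
    the form expected by \<open>computable_on_two_prod_encode\<close>.\<close>
  unfolding color_search_def mult_2[of "F _ _"]
proof (rule computable_on_Least)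
  show "decidable_on {coloring_code B f |f. Q f} (Suc k)
      (\<lambda>A xs. F A (tl xs) + F A (tl xs) \<notin> A \<or> 2 * prod_encode (F A (tl xs), hd xs) + 1 \<in> A)"
    by (intro decidable_on_disj decidable_on_not decidable_on_oracle computable_on_add
        computable_on_two_prod_encode computable_on_tl[OF F] computable_on_hd) simp
  fix A and xs :: "nat list"
  assume "A \<in> {coloring_code B f |f. Q f}"
  then obtain f where "A = coloring_code B f" by blast
  \<comment> \<open>A number in the domain half is the code of some \<open>s\<close> in
    \<open>B\<close>, and then \<open>v = f s\<close> ends the search.\<close>
  then show "\<exists>v. F A xs + F A xs \<notin> A \<or> 2 * prod_encode (F A xs, v) + 1 \<in> A"
    unfolding mult_2[of "F _ _", symmetric]
    using even_mem_coloring_code[of "F A xs"] odd_mem_coloring_code by metis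
qed

lemma computable_on_twin_search:
  assumes F: "computable_on {coloring_code B f |f. Q f} k F"
  shows "computable_on {coloring_code B f |f. Q f} k (\<lambda>A xs. twin_search A (F A xs))"
  unfolding twin_search_def
proof (rule computable_on_Least)
  \<comment> \<open>\<open>F1\<close> puts \<open>F\<close> under the search variable,
    \<open>F2\<close> also under the quantifier over \<open>c\<close>.\<close>
  note F1 = computable_on_tl[OF F]
  note F2 = computable_on_tl[OF F1]
  show "decidable_on {coloring_code B f |f. Q f} (Suc k)
      (\<lambda>A xs. F A (tl xs) \<le> hd xs \<or> (\<exists>c<F A (tl xs).
        2 * prod_encode (c, color_search A (F A (tl xs))) + 1 \<in> A \<and>
        hd xs \<in> set_decode c \<and> hd xs \<notin> set_decode (F A (tl xs))))"
    by (intro decidable_on_disj decidable_on_conj decidable_on_not decidable_on_oracle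
        decidable_on_le decidable_on_bex decidable_on_mem_set_decode
        computable_on_two_prod_encode computable_on_color_search F1 F2
        computable_on_tl[OF computable_on_hd] computable_on_hd) simp_all
qed blast

section \<open>The functional producing the new coloring\<close>

text \<open>Neither \<open>2 * a\<close> nor a pair code with first component \<open>a\<close> is
  smaller than \<open>a\<close>. Hence the sets of \<open>B\<close> that can contribute
  \<open>n\<close> have codes at most \<open>n\<close>, and membership becomes a bounded
  search.\<close>

lemma mem_coloring_code_twin_coloring:
  fixes B f
  defines "A \<equiv> coloring_code B f"
  shows "n \<in> coloring_code B (twin_coloring B f) \<longleftrightarrow>
    (\<exists>a<Suc n. a + a \<in> A \<and> (n = a + a \<or> n = 2 * prod_encode (a, twin_search A a) + 1))"
proof -
  let ?Q = "\<lambda>a. n = 2 * a \<or> n = 2 * prod_encode (a, twin_search A a) + 1"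
  have "a < Suc n" if "?Q a" for a
    using that le_prod_encode_1[of a "twin_search A a"] by linarith
  then have bound: "(\<exists>a<Suc n. R a \<and> ?Q a) \<longleftrightarrow> (\<exists>a. R a \<and> ?Q a)" for R
    by blast
  have "n \<in> coloring_code B (twin_coloring B f) \<longleftrightarrow> (\<exists>s\<in>B. ?Q (set_encode s))"
    unfolding coloring_code_def[of B "twin_coloring B f"] twin_coloring_def A_def by blast
  also have "\<dots> \<longleftrightarrow> (\<exists>a. 2 * a \<in> A \<and> ?Q a)"
    unfolding A_def even_mem_coloring_code by blast
  finally show ?thesis unfolding mult_2[symmetric] bound .
qed

lemma turing_functional_twin_coloring:
  obtains \<Phi> where "turing_functional \<Phi>"
    "\<And>f. \<Phi> (coloring_code B f) = Some (coloring_code B (twin_coloring B f))"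
proof -
  have "decidable_on {coloring_code B f |f. True} (Suc 0) (\<lambda>A xs. \<exists>a<Suc (hd xs).
      a + a \<in> A \<and> (hd xs = a + a \<or> hd xs = 2 * prod_encode (a, twin_search A a) + 1))"
    by (intro decidable_on_bex decidable_on_conj decidable_on_disj decidable_on_eq
        decidable_on_oracle computable_on_Suc computable_on_add computable_on_two_prod_encode
        computable_on_twin_search computable_on_tl[OF computable_on_hd] computable_on_hd) simp_all
  then obtain p where p: "\<And>A xs. A \<in> {coloring_code B f |f. True} \<Longrightarrow> length xs = Suc 0 \<Longrightarrow>
      oeval A p xs (of_bool (\<exists>a<Suc (hd xs).
        a + a \<in> A \<and> (hd xs = a + a \<or> hd xs = 2 * prod_encode (a, twin_search A a) + 1)))"
    by (rule computable_onE) blast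
  have "functional p (coloring_code B f) = Some (coloring_code B (twin_coloring B f))" for f
    unfolding functional_eq_Some_iff
  proof
    fix n
    have "coloring_code B f \<in> {coloring_code B f |f. True}" by blast
    from p[OF this, of "[n]"]
    show "oeval (coloring_code B f) p [n] (of_bool (n \<in> coloring_code B (twin_coloring B f)))"
      unfolding mem_coloring_code_twin_coloring by (simp only: list.sel length_Cons list.size)
  qed
  then show thesis
    using that[of "functional p"] unfolding turing_functional_def by blast
qed

text \<open>The identity is the backward functional of the reduction.\<close>

lemma functional_Oracle: "functional Oracle A = Some A"
  unfolding functional_eq_Some_iff by (intro allI oeval.query)

section \<open>The reduction\<close>

text \<open>Since \<open>set_encode\<close> is injective on finite sets, the coded graph is
  single-valued; this is why \<open>color_search\<close> finds the right color.\<close>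

lemma odd_mem_coloring_code_finite:
  assumes "\<forall>s\<in>B. finite s" "finite s"
  shows "2 * prod_encode (set_encode s, v) + 1 \<in> coloring_code B f \<longleftrightarrow> s \<in> B \<and> v = f s"
  unfolding odd_mem_coloring_code using assms by (auto simp: set_encode_eq_iff)

lemma color_search_coloring_code:
  assumes "\<forall>s\<in>B. finite s" "s \<in> B"
  shows "color_search (coloring_code B f) (set_encode s) = f s"
proof -
  have "2 * set_encode s \<in> coloring_code B f"
    using assms(2) unfolding even_mem_coloring_code by blast
  moreover have "2 * prod_encode (set_encode s, v) + 1 \<in> coloring_code B f \<longleftrightarrow> v = f s" for v
    using odd_mem_coloring_code_finite assms by blast
  ultimately show ?thesis
    unfolding color_search_def by (auto intro: Least_equality)
qed

text \<open>Otherwise \<open>s\<close>, \<open>t\<close> and \<open>u\<close> would be three sets of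
  one color.\<close>

lemma two_bounded_unique_twin:
  assumes "two_bounded B f" "s \<in> B" "t \<in> B" "u \<in> B" "f t = f s" "f u = f s" "t \<noteq> s" "u \<noteq> s"
  shows "t = u"
proof (rule ccontr)
  assume "t \<noteq> u"
  then have "card {s, t, u} = 3" using assms by simp
  moreover have "{s, t, u} \<subseteq> {r \<in> B. f r = f s}" using assms by auto
  moreover have "finite {r \<in> B. f r = f s}" "card {r \<in> B. f r = f s} \<le> 2"
    using assms(1) unfolding two_bounded_def by blast+
  ultimately show False
    using card_mono[of "{r \<in> B. f r = f s}" "{s, t, u}"] by linarith
qed

text \<open>The antichain condition supplies an element of \<open>t - s\<close> that lies below the
  cutoff, so \<open>twin_search\<close> ends with a genuine witness. By 2-boundedness the set coded
  by that witness \<open>c\<close> can only be \<open>t\<close>.\<close>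

lemma twin_coloring_mem_diff:
  assumes fin: "\<forall>s\<in>B. finite s" and antichain: "\<forall>s\<in>B. \<forall>t\<in>B. \<not> s \<subset> t"
    and bdd: "two_bounded B f"
    and "s \<in> B" "t \<in> B" "f t = f s" "set_encode t < set_encode s"
  shows "twin_coloring B f s \<in> t - s"
proof -
  define A where "A = coloring_code B f"
  define P where "P b \<longleftrightarrow> set_encode s \<le> b \<or> (\<exists>c<set_encode s.
    2 * prod_encode (c, f s) + 1 \<in> A \<and> b \<in> set_decode c \<and> b \<notin> set_decode (set_encode s))" for b
  have g: "twin_coloring B f s = (LEAST b. P b)"
    unfolding twin_coloring_def twin_search_def color_search_coloring_code[OF fin \<open>s \<in> B\<close>]
      P_def A_def by (rule refl)
  have "t \<noteq> s" using \<open>set_encode t < set_encode s\<close> by auto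
  moreover have "\<not> t \<subset> s" by (rule antichain[THEN bspec, OF \<open>t \<in> B\<close>, THEN bspec, OF \<open>s \<in> B\<close>])
  ultimately have "\<not> t \<subseteq> s" by (simp add: psubset_eq)
  then obtain i where i: "i \<in> t" "i \<notin> s" unfolding subset_iff by auto
  have dec: "set_decode (set_encode r) = r" if "r \<in> B" for r
    using that fin by simp
  have "2 * prod_encode (set_encode t, f s) + 1 \<in> A"
    unfolding A_def odd_mem_coloring_code using \<open>t \<in> B\<close> \<open>f t = f s\<close> by (intro bexI[of _ t]) simp_all
  then have "P i"
    unfolding P_def using i \<open>set_encode t < set_encode s\<close>
    by (intro disjI2 exI[of _ "set_encode t"]) (simp add: dec \<open>s \<in> B\<close> \<open>t \<in> B\<close>)
  then have P: "P (LEAST b. P b)" and "(LEAST b. P b) \<le> i"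
    by (rule LeastI, rule Least_le)
  moreover have "i < set_encode t"
    using less_set_encode fin i(1) \<open>t \<in> B\<close> by blast
  \<comment> \<open>The least \<open>b\<close> is at most \<open>i\<close>, which is below the code
    of its set \<open>t\<close> and hence below the cutoff \<open>set_encode s\<close>.\<close>
  ultimately have "\<not> set_encode s \<le> (LEAST b. P b)"
    using \<open>set_encode t < set_encode s\<close> by linarith
  with P obtain c where c: "c < set_encode s" "2 * prod_encode (c, f s) + 1 \<in> A"
      "(LEAST b. P b) \<in> set_decode c" "(LEAST b. P b) \<notin> set_decode (set_encode s)"
    unfolding P_def[of "LEAST b. P b"] by blast
  obtain u where u: "u \<in> B" "c = set_encode u" "f u = f s"
    using c(2) unfolding A_def odd_mem_coloring_code by auto
  have "u \<noteq> s" using c(1) u(2) by auto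
  then have "t = u"
    using two_bounded_unique_twin[OF bdd \<open>s \<in> B\<close> \<open>t \<in> B\<close> u(1) \<open>f t = f s\<close> u(3) \<open>t \<noteq> s\<close>] by blast
  then show ?thesis
    unfolding g using c(3,4) u(2) dec[OF \<open>s \<in> B\<close>] dec[OF \<open>t \<in> B\<close>] by simp
qed

theorem proposition11:
  fixes B :: "nat set set"
  assumes "barrier B"
  shows "RRT2 B \<le>\<^sub>s\<^sub>W FS B"
proof -
  have fin: "\<forall>s\<in>B. finite s" and antichain: "\<forall>s\<in>B. \<forall>t\<in>B. \<not> s \<subset> t"
    using assms unfolding barrier_def barrier_on_def by blast+
  obtain \<Phi> where \<Phi>: "turing_functional \<Phi>"
    "\<And>f. \<Phi> (coloring_code B f) = Some (coloring_code B (twin_coloring B f))"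
    using turing_functional_twin_coloring[of B] by blast
  have sol: "Y \<in> solutions (RRT2 B) (coloring_code B f)"
    if bdd: "two_bounded B f" and Y: "Y \<in> solutions (FS B) (coloring_code B (twin_coloring B f))"
    for f Y
  proof -
    \<comment> \<open>A solution comes with some coloring \<open>g\<close> of the given code;
      equality of codes forces \<open>g\<close> to agree with \<open>twin_coloring B f\<close> on
      \<open>B\<close>.\<close>
    obtain g where "coloring_code B (twin_coloring B f) = coloring_code B g"
      and Y': "infinite Y" "Y \<subseteq> base B" and free: "\<forall>s \<in> B \<restriction> Y. g s \<in> Y \<longrightarrow> g s \<in> s"
      using Y unfolding FS_def by auto
    then have g: "\<forall>s\<in>B. twin_coloring B f s = g s"
      using coloring_code_eq_iff fin by blast
    have no_twin: "\<not> set_encode t < set_encode s"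
      if "s \<in> B \<restriction> Y" "t \<in> B \<restriction> Y" "f t = f s" for s t
    proof
      assume "set_encode t < set_encode s"
      then have "g s \<in> t - s"
        using twin_coloring_mem_diff[OF fin antichain bdd] that g unfolding restr_def by auto
      \<comment> \<open>The value \<open>g s\<close> lies in \<open>t\<close>, hence in
        \<open>Y\<close>, but outside \<open>s\<close>.\<close>
      then show False using free that unfolding restr_def by blast
    qed
    have "inj_on f (B \<restriction> Y)"
    proof (rule inj_onI)
      fix s t assume st: "s \<in> B \<restriction> Y" "t \<in> B \<restriction> Y" "f s = f t"
      \<comment> \<open>\<open>no_twin\<close> applies in both orders, since the colors
        agree.\<close>
      then have "set_encode s = set_encode t"
        using no_twin by (metis linorder_neqE_nat)
      moreover have "finite s" "finite t" using st(1,2) fin unfolding restr_def by blast+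
      ultimately show "s = t" by (simp add: set_encode_eq_iff)
    qed
    then show ?thesis using bdd Y' unfolding RRT2_def by auto
  qed
  have "turing_functional (functional Oracle)" unfolding turing_functional_def by blast
  moreover have "\<exists>J \<in> instances (FS B). \<Phi> I = Some J \<and>
      (\<forall>Y \<in> solutions (FS B) J. \<exists>Z \<in> solutions (RRT2 B) I. functional Oracle Y = Some Z)"
    if I: "I \<in> instances (RRT2 B)" for I
  proof -
    obtain f where f: "I = coloring_code B f" "two_bounded B f"
      using I unfolding RRT2_def by auto
    have "coloring_code B (twin_coloring B f) \<in> instances (FS B)"
      unfolding FS_def by auto
    then show ?thesis using \<Phi>(2) sol f functional_Oracle by blast
  qed
  ultimately show ?thesis using \<Phi>(1) unfolding sW_reducible_def by blast
qed

end
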